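(* Let $X, Y \in \mathscr{M}_\lambda$, and assume that $\dim(X) = 0$ (Lebesgue covering dimension) if $\mu = \omega$. For every function $f \colon X \to Y$, the following are equivalent: (1) $f$ is $\lambda^+$-Borel measurable; (2) $f$ belongs to the $\widehat{\mathrm{Fin}}_\lambda$-closure of the collection of all continuous functions from $X$ to $Y$.
   Context: Work in ZFC. $\lambda$ is an uncountable cardinal with $2^{<\lambda} = \lambda$, and $\mu = \operatorname{cof}(\lambda)$. All topological spaces are regular Hausdorff. Let $\mathbb{G} = \mathbb{R}$ if $\mu = \omega$; if $\mu > \omega$, $\mathbb{G}$ is a fixed ordered field whose positive part $\mathbb{G}^+$ has coinitiality $\mu$ (the choice is irrelevant). A space is $\mu$-metrizable if its topology is induced by a $\mathbb{G}$-valued metric. $\mathscr{M}_\lambda$ is the class of $\mu$-metrizable spaces of weight at most $\lambda$. A subset of $X$ is $\lambda^+$-Borel if it belongs to the smallest family containing the open sets and closed under complements and unions of size $\le\lambda$; $f\colon X\to Y$ is $\lambda^+$-Borel measurable if preimages of open sets are $\lambda^+$-Borel. For a directed set $D$ and functions $f, f_d \colon X \to Y$, $f=\lim_{d\in D} f_d$ means: for every $x \in X$ and every open neighborhood $U$ of $f(x)$ there is $d\in D$ with $f_{d'}(x)\in U$ for all $d'\ge d$. For a directed set $D$ and a collection $\mathcal{F}$ of functions $X \to Y$, the $D$-closure of $\mathcal{F}$ is the smallest collection containing $\mathcal{F}$ and containing $\lim_{d \in D} f_d$ whenever $(f_d)_{d\in D}$ is a family from the collection whose pointwise $D$-limit exists.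 For $d \in {}^{\lambda}\lambda$ let $\operatorname{supp}(d)=\{i<\lambda \mid d(i)\neq 0\}$. $\widehat{\mathrm{Fin}}_\lambda = \{d \in {}^\lambda\lambda \mid \operatorname{supp}(d) \text{ finite and } d(i) < 2+i \text{ for all } i<\lambda\}$, ordered pointwise: $d\le d'$ iff $d(i)\le d'(i)$ for all $i<\lambda$. *)

theory Defs
  imports "HOL-Analysis.Analysis"
begin

unbundle cardinal_syntax

text \<open>A cardinal \<open>lam\<close> is a relation with \<open>Card_order lam\<close>; the elements of \<open>Field lam\<close>,
  ordered by \<open>lam\<close>, play the role of the ordinals below it, and the ordinal represented by
  \<open>a\<close> is \<open>ord_below lam a\<close>, the well-ordered set of its predecessors.\<close>

definition ord_below :: "'l rel \<Rightarrow> 'l \<Rightarrow> 'l rel" where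
  "ord_below lam a = Restr lam (underS lam a)"

definition ord_zero :: "'l rel \<Rightarrow> 'l" where
  "ord_zero lam = wo_rel.minim lam (Field lam)"

definition ord_sum :: "'a rel \<Rightarrow> 'b rel \<Rightarrow> ('a + 'b) rel" where
  "ord_sum r s = {(Inl a, Inl a') |a a'. (a, a') \<in> r} \<union> {(Inr b, Inr b') |b b'. (b, b') \<in> s}
     \<union> {(Inl a, Inr b) |a b. a \<in> Field r \<and> b \<in> Field s}"

text \<open>\<open>2\<^bsup><lam\<^esup>\<close> as the number of binary sequences of length less than \<open>lam\<close>.\<close>

definition two_pow_less :: "'l rel \<Rightarrow> ('l \<times> ('l \<Rightarrow> bool)) rel" where
  "two_pow_less lam = (CSUM a : lam. ctwo ^c |underS lam a| )"

definition has_cofinality :: "'l rel \<Rightarrow> 'm rel \<Rightarrow> bool" where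
  "has_cofinality r mu \<longleftrightarrow> Card_order mu \<and>
     (\<exists>A \<subseteq> Field r. cofinal A r \<and> |A| =o mu) \<and>
     (\<forall>A \<subseteq> Field r. cofinal A r \<longrightarrow> mu \<le>o |A| )"

definition has_pos_coinitiality :: "'g::linordered_field itself \<Rightarrow> 'm rel \<Rightarrow> bool" where
  "has_pos_coinitiality G mu \<longleftrightarrow> Card_order mu \<and>
     (\<exists>A \<subseteq> {0::'g<..}. (\<forall>g>0. \<exists>a\<in>A. a \<le> g) \<and> |A| =o mu) \<and>
     (\<forall>A \<subseteq> {0::'g<..}. (\<forall>g>0. \<exists>a\<in>A. a \<le> g) \<longrightarrow> mu \<le>o |A| )"

definition field_metric :: "'a set \<Rightarrow> ('a \<Rightarrow> 'a \<Rightarrow> 'g::linordered_field) \<Rightarrow> bool" where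
  "field_metric M d \<longleftrightarrow>
     (\<forall>x\<in>M. \<forall>y\<in>M. 0 \<le> d x y \<and> (d x y = 0 \<longleftrightarrow> x = y) \<and> d x y = d y x) \<and>
     (\<forall>x\<in>M. \<forall>y\<in>M. \<forall>z\<in>M. d x z \<le> d x y + d y z)"

definition field_metrizable :: "'g::linordered_field itself \<Rightarrow> 'a topology \<Rightarrow> bool" where
  "field_metrizable G X \<longleftrightarrow>
     (\<exists>d :: 'a \<Rightarrow> 'a \<Rightarrow> 'g. field_metric (topspace X) d \<and>
        (\<forall>U. openin X U \<longleftrightarrow>
           U \<subseteq> topspace X \<and> (\<forall>x\<in>U. \<exists>e>0. {y \<in> topspace X. d x y < e} \<subseteq> U)))"

text \<open>The field is the reals for \<open>mu = \<omega>\<close>, and the parameter \<open>G\<close> is used only for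
  uncountable \<open>mu\<close>.\<close>

definition mu_metrizable :: "'g::linordered_field itself \<Rightarrow> 'm rel \<Rightarrow> 'a topology \<Rightarrow> bool" where
  "mu_metrizable G mu X \<longleftrightarrow> (if mu =o natLeq then metrizable_space X else field_metrizable G X)"

definition weight_le :: "'a topology \<Rightarrow> 'l rel \<Rightarrow> bool" where
  "weight_le X lam \<longleftrightarrow>
     (\<exists>\<B>. |\<B>| \<le>o lam \<and> (\<forall>V\<in>\<B>. openin X V) \<and>
        (\<forall>U x. openin X U \<and> x \<in> U \<longrightarrow> (\<exists>V\<in>\<B>. x \<in> V \<and> V \<subseteq> U)))"

definition space_class :: "'g::linordered_field itself \<Rightarrow> 'l rel \<Rightarrow> 'm rel \<Rightarrow> 'a topology \<Rightarrow> bool" where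
  "space_class G lam mu X \<longleftrightarrow> mu_metrizable G mu X \<and> weight_le X lam"

text \<open>The library's \<open>dim_le\<close> is the small inductive dimension, which need not agree with the
  covering dimension on non-separable metrizable spaces.  For \<open>n = -1\<close> the definition below
  says that the space is empty.\<close>

definition covering_dim_le :: "'a topology \<Rightarrow> int \<Rightarrow> bool" where
  "covering_dim_le X n \<longleftrightarrow> -1 \<le> n \<and>
     (\<forall>\<U>. (\<forall>U\<in>\<U>. openin X U) \<and> \<Union>\<U> = topspace X \<longrightarrow>
        (\<exists>\<V>. (\<forall>V\<in>\<V>. openin X V \<and> (\<exists>U\<in>\<U>. V \<subseteq> U)) \<and> \<Union>\<V> = topspace X \<and>
           (\<forall>x\<in>topspace X. finite {V\<in>\<V>. x \<in> V} \<and> int (card {V\<in>\<V>. x \<in> V}) \<le> n + 1)))"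

definition has_covering_dim :: "'a topology \<Rightarrow> int \<Rightarrow> bool" where
  "has_covering_dim X n \<longleftrightarrow> covering_dim_le X n \<and> (\<forall>m<n. \<not> covering_dim_le X m)"

inductive_set lam_borel :: "'l rel \<Rightarrow> 'a topology \<Rightarrow> 'a set set"
  for lam :: "'l rel" and X :: "'a topology" where
  lam_borel_open: "openin X U \<Longrightarrow> U \<in> lam_borel lam X"
| lam_borel_compl: "A \<in> lam_borel lam X \<Longrightarrow> topspace X - A \<in> lam_borel lam X"
| lam_borel_Union: "(\<And>A. A \<in> \<A> \<Longrightarrow> A \<in> lam_borel lam X) \<Longrightarrow> |\<A>| \<le>o lam \<Longrightarrow>
    \<Union>\<A> \<in> lam_borel lam X"

definition lam_borel_measurable :: "'l rel \<Rightarrow> 'a topology \<Rightarrow> 'b topology \<Rightarrow> ('a \<Rightarrow> 'b) \<Rightarrow> bool" where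
  "lam_borel_measurable lam X Y f \<longleftrightarrow> f \<in> topspace X \<rightarrow> topspace Y \<and>
     (\<forall>U. openin Y U \<longrightarrow> {x \<in> topspace X. f x \<in> U} \<in> lam_borel lam X)"

definition pointwise_lim ::
  "'a topology \<Rightarrow> 'b topology \<Rightarrow> 'd set \<Rightarrow> ('d \<Rightarrow> 'd \<Rightarrow> bool) \<Rightarrow> ('d \<Rightarrow> 'a \<Rightarrow> 'b) \<Rightarrow> ('a \<Rightarrow> 'b) \<Rightarrow> bool" where
  "pointwise_lim X Y D le fs f \<longleftrightarrow>
     (\<forall>x\<in>topspace X. \<forall>U. openin Y U \<and> f x \<in> U \<longrightarrow>
        (\<exists>d\<in>D. \<forall>d'\<in>D. le d d' \<longrightarrow> fs d' x \<in> U))"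

text \<open>Functions from \<open>X\<close> to \<open>Y\<close> are extensional, so that each is represented once.\<close>

inductive_set net_closure ::
  "'a topology \<Rightarrow> 'b topology \<Rightarrow> 'd set \<Rightarrow> ('d \<Rightarrow> 'd \<Rightarrow> bool) \<Rightarrow> ('a \<Rightarrow> 'b) set \<Rightarrow> ('a \<Rightarrow> 'b) set"
  for X :: "'a topology" and Y :: "'b topology" and D :: "'d set" and le :: "'d \<Rightarrow> 'd \<Rightarrow> bool"
    and \<F> :: "('a \<Rightarrow> 'b) set" where
  net_closure_base: "f \<in> \<F> \<Longrightarrow> f \<in> net_closure X Y D le \<F>"
| net_closure_lim: "(\<And>d. d \<in> D \<Longrightarrow> fs d \<in> net_closure X Y D le \<F>) \<Longrightarrow>
    f \<in> topspace X \<rightarrow>\<^sub>E topspace Y \<Longrightarrow> pointwise_lim X Y D le fs f \<Longrightarrow>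
    f \<in> net_closure X Y D le \<F>"

definition continuous_functions :: "'a topology \<Rightarrow> 'b topology \<Rightarrow> ('a \<Rightarrow> 'b) set" where
  "continuous_functions X Y = {f \<in> topspace X \<rightarrow>\<^sub>E topspace Y. continuous_map X Y f}"

definition ord_supp :: "'l rel \<Rightarrow> ('l \<Rightarrow> 'l) \<Rightarrow> 'l set" where
  "ord_supp lam d = {i \<in> Field lam. d i \<noteq> ord_zero lam}"

text \<open>The condition \<open>d(i) < 2 + i\<close> compares order types, \<open>2 + i\<close> being the ordinal sum
  (which is \<open>i\<close> itself for infinite \<open>i\<close>).\<close>

definition Fin_hat :: "'l rel \<Rightarrow> ('l \<Rightarrow> 'l) set" where
  "Fin_hat lam = {d \<in> Field lam \<rightarrow>\<^sub>E Field lam. finite (ord_supp lam d) \<and>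
     (\<forall>i\<in>Field lam. ord_below lam (d i) <o ord_sum (natLeq_on 2) (ord_below lam i))}"

definition Fin_hat_le :: "'l rel \<Rightarrow> ('l \<Rightarrow> 'l) \<Rightarrow> ('l \<Rightarrow> 'l) \<Rightarrow> bool" where
  "Fin_hat_le lam d d' \<longleftrightarrow> (\<forall>i\<in>Field lam. (d i, d' i) \<in> lam)"

end

theory Submission
  imports Defs
begin

text \<open>
  Call a set \<open>A\<close> good if the closure is stable under taking two of its members and gluing them
  along \<open>A\<close> and its complement.  Good sets form a \<open>\<lambda>\<^sup>+\<close>-algebra: a union of \<open>\<le> \<lambda>\<close> good
  sets is the limit of its finite subunions, and the supports of the elements of \<open>Fin_hat\<close>
  simulate the net of finite subsets of \<open>\<lambda>\<close>.  Clopen sets are good and form a base of \<open>X\<close>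
  (this is the covering dimension for \<open>\<mu> = \<omega>\<close>, while for \<open>\<mu> > \<omega>\<close> the sets
  \<open>{y. \<forall>n. d x y < e / 2\<^sup>n}\<close> are clopen), so all \<open>\<lambda>\<^sup>+\<close>-Borel sets are good.  Hence every
  Borel function with \<open>\<le> \<lambda>\<close> values is in the closure.  Finally, \<open>f\<close> is the limit of such
  functions \<open>f\<^sub>a\<close> with \<open>d (f\<^sub>a x) (f x) < a\<close>, along the finite subsets \<open>S\<close> of a coinitial set
  of positive elements of the field, taking \<open>a = Min S\<close>.  In the other direction,
  \<open>Fin_hat\<close> is directed and has at most \<open>\<lambda>\<close> elements.
\<close>

section \<open>Ordinals and cardinalities\<close>

lemma finite_card_of_le_infinite:
  assumes "finite A" and "infinite B"
  shows "|A| \<le>o |B|"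
  using finite_ordLess_infinite[OF card_of_Well_order card_of_Well_order, of A B] assms
  by (simp add: ordLess_imp_ordLeq Field_card_of)

lemma ord_sum_simps:
  "(Inl a, Inl a') \<in> ord_sum r s \<longleftrightarrow> (a, a') \<in> r"
  "(Inr b, Inr b') \<in> ord_sum r s \<longleftrightarrow> (b, b') \<in> s"
  "(Inl a, Inr b) \<in> ord_sum r s \<longleftrightarrow> a \<in> Field r \<and> b \<in> Field s"
  "(Inr b, Inl a) \<notin> ord_sum r s"
  unfolding ord_sum_def by auto

lemma Field_ord_sum:
  assumes "Well_order r" and "Well_order s"
  shows "Field (ord_sum r s) = Inl ` Field r \<union> Inr ` Field s"
proof -
  have refl: "refl_on (Field r) r" "refl_on (Field s) s" using assms by (auto simp: order_on_defs)
  have "(Inl a, Inl a) \<in> ord_sum r s" if "a \<in> Field r" for a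
    using refl that by (auto simp: ord_sum_def refl_on_def)
  moreover have "(Inr b, Inr b) \<in> ord_sum r s" if "b \<in> Field s" for b
    using refl that by (auto simp: ord_sum_def refl_on_def)
  ultimately have "Inl ` Field r \<union> Inr ` Field s \<subseteq> Field (ord_sum r s)"
    by (auto intro: FieldI1)
  moreover have "u \<in> Inl ` Field r \<union> Inr ` Field s \<and> v \<in> Inl ` Field r \<union> Inr ` Field s"
    if "(u, v) \<in> ord_sum r s" for u v
    using that unfolding ord_sum_def by (auto intro: FieldI1 FieldI2)
  then have "Field (ord_sum r s) \<subseteq> Inl ` Field r \<union> Inr ` Field s"
    unfolding Field_def by blast
  ultimately show ?thesis by blast
qed

lemma Well_order_ord_sum:
  assumes r: "Well_order r" and s: "Well_order s"
  shows "Well_order (ord_sum r s)"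
proof -
  have ro: "refl_on (Field r) r" "trans r" "antisym r" "total_on (Field r) r" "wf (r - Id)"
    and so: "refl_on (Field s) s" "trans s" "antisym s" "total_on (Field s) s" "wf (s - Id)"
    using r s by (auto simp: order_on_defs)
  have rf: "a \<in> Field r" "b \<in> Field r" if "(a, b) \<in> r" for a b
    using that by (auto simp: Field_def)
  have sf: "a \<in> Field s" "b \<in> Field s" if "(a, b) \<in> s" for a b
    using that by (auto simp: Field_def)
  have "refl_on (Field (ord_sum r s)) (ord_sum r s)"
    unfolding Field_ord_sum[OF r s] using ro(1) so(1)
    by (auto simp: refl_on_def ord_sum_def)
  moreover have "trans (ord_sum r s)"
    unfolding trans_def ord_sum_def using rf sf ro(2) so(2)
    by (auto dest: transD)
  moreover have "antisym (ord_sum r s)"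
    unfolding antisym_def ord_sum_def using ro(3) so(3) by (auto dest: antisymD)
  moreover have "total_on (Field (ord_sum r s)) (ord_sum r s)"
    unfolding Field_ord_sum[OF r s]
  proof (rule total_onI)
    have rt: "(a, b) \<in> r \<or> (b, a) \<in> r" if "a \<in> Field r" "b \<in> Field r" "a \<noteq> b" for a b
      using ro(4) that unfolding total_on_def by metis
    have st: "(a, b) \<in> s \<or> (b, a) \<in> s" if "a \<in> Field s" "b \<in> Field s" "a \<noteq> b" for a b
      using so(4) that unfolding total_on_def by metis
    fix u v :: "'a + 'b"
    assume "u \<in> Inl ` Field r \<union> Inr ` Field s" "v \<in> Inl ` Field r \<union> Inr ` Field s" "u \<noteq> v"
    then show "(u, v) \<in> ord_sum r s \<or> (v, u) \<in> ord_sum r s"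
      by (elim UnE imageE) (simp_all add: ord_sum_simps rt st)
  qed
  moreover have "wf (ord_sum r s - Id)"
    unfolding wf_eq_minimal
  proof (intro allI impI)
    fix Q :: "('a + 'b) set" and x assume "x \<in> Q"
    show "\<exists>z\<in>Q. \<forall>y. (y, z) \<in> ord_sum r s - Id \<longrightarrow> y \<notin> Q"
    proof (cases "\<exists>a. Inl a \<in> Q")
      case True
      then obtain a where a: "Inl a \<in> Q" "\<And>b. (b, a) \<in> r - Id \<Longrightarrow> Inl b \<notin> Q"
        by (elim exE) (rule wfE_min[OF ro(5), of _ "Inl -` Q"]; auto)
      show ?thesis
        by (rule bexI[OF _ a(1)]) (use a(2) in \<open>auto simp: ord_sum_def\<close>)
    next
      case False
      then obtain b0 where "Inr b0 \<in> Q" using \<open>x \<in> Q\<close> by (metis sum.exhaust)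
      then obtain a where a: "Inr a \<in> Q" "\<And>b. (b, a) \<in> s - Id \<Longrightarrow> Inr b \<notin> Q"
        by (rule_tac wfE_min[OF so(5), of _ "Inr -` Q"]) auto
      show ?thesis
        by (rule bexI[OF _ a(1)]) (use a(2) False in \<open>auto simp: ord_sum_def\<close>)
    qed
  qed
  ultimately show ?thesis
    by (auto simp: order_on_defs Field_def)
qed

lemma ord_below_less_two_plus:
  assumes lam: "Well_order lam" and sub: "underS lam a \<subseteq> {z}"
  shows "ord_below lam a <o ord_sum (natLeq_on 2) (ord_below lam i)"
proof -
  have wb: "Well_order (ord_below lam b)" for b
    unfolding ord_below_def by (rule Well_order_Restr[OF lam])
  have wsum: "Well_order (ord_sum (natLeq_on 2) (ord_below lam i))"
    by (rule Well_order_ord_sum[OF natLeq_on_Well_order wb])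
  show ?thesis
  proof (rule ccontr)
    assume "\<not> ?thesis"
    then have "ord_sum (natLeq_on 2) (ord_below lam i) \<le>o ord_below lam a"
      using not_ordLess_iff_ordLeq wb wsum by blast
    then have "|Field (ord_sum (natLeq_on 2) (ord_below lam i))| \<le>o |Field (ord_below lam a)|"
      by (rule card_of_mono2)
    then obtain g where g: "inj_on g (Field (ord_sum (natLeq_on 2) (ord_below lam i)))"
      and gi: "g ` Field (ord_sum (natLeq_on 2) (ord_below lam i)) \<subseteq> Field (ord_below lam a)"
      unfolding card_of_ordLeq[symmetric] by blast
    have fa: "Field (ord_below lam a) \<subseteq> {z}"
      using sub unfolding ord_below_def Field_def by auto
    have "(0::nat) \<in> Field (natLeq_on 2)" "(1::nat) \<in> Field (natLeq_on 2)"
      by (auto simp: Field_natLeq_on)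
    then have F: "Inl (0::nat) \<in> Field (ord_sum (natLeq_on 2) (ord_below lam i))"
      "Inl (1::nat) \<in> Field (ord_sum (natLeq_on 2) (ord_below lam i))"
      unfolding Field_ord_sum[OF natLeq_on_Well_order wb] by auto
    then have "g (Inl 0) = z" "g (Inl 1) = z" using gi fa by auto
    then have "g (Inl 0) = g (Inl 1)" by simp
    from inj_onD[OF g this F] show False by simp
  qed
qed

lemma card_of_Fpow_le:
  assumes "infinite A"
  shows "|Fpow A| \<le>o |A|"
proof -
  define F where "F n = {S. S \<subseteq> A \<and> finite S \<and> card S = n}" for n :: nat
  have "|F n| \<le>o |A|" for n
  proof (induction n)
    case 0
    have "F 0 \<subseteq> {{}}" unfolding F_def by auto
    then have "finite (F 0)" using finite_subset by blast
    then show ?case using assms by (rule finite_card_of_le_infinite)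
  next
    case (Suc n)
    have "F (Suc n) \<subseteq> (\<lambda>(a, S). insert a S) ` (A \<times> F n)"
    proof
      fix S assume "S \<in> F (Suc n)"
      then obtain a T where "S = insert a T" "a \<notin> T" "card T = n" "S \<subseteq> A" "finite S"
        unfolding F_def by (auto simp: card_Suc_eq)
      then show "S \<in> (\<lambda>(a, S). insert a S) ` (A \<times> F n)"
        unfolding F_def by (auto simp: image_iff)
    qed
    then have "|F (Suc n)| \<le>o |A \<times> F n|"
      using card_of_image card_of_mono1 ordLeq_transitive by blast
    also have "|A \<times> F n| \<le>o |A|"
      using assms Suc.IH
      by (intro card_of_Times_ordLeq_infinite_Field) (auto simp: Field_card_of card_of_card_order_on card_of_mono1)
    finally show ?case .
  qed
  then have "|\<Union>n\<in>UNIV. F n| \<le>o |A|"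
    using assms infinite_iff_card_of_nat by (intro card_of_UNION_ordLeq_infinite) auto
  moreover have "Fpow A = (\<Union>n\<in>UNIV. F n)" unfolding Fpow_def F_def by auto
  ultimately show ?thesis by simp
qed

lemma cofinal_infinite:
  assumes "Card_order r" and "infinite (Field r)" and "A \<subseteq> Field r" and "cofinal A r"
  shows "infinite A"
proof
  assume "finite A"
  interpret wo_rel r using assms(1) by (simp add: wo_rel_def card_order_on_def)
  have "A \<noteq> {}" using assms(2,4) unfolding cofinal_def by (metis finite.emptyI equals0I empty_iff)
  have "\<exists>m\<in>B. \<forall>b\<in>B. (b, m) \<in> r" if "finite B" "B \<noteq> {}" "B \<subseteq> A" for B
    using that
  proof (induction B rule: finite_ne_induct)
    case (singleton x)
    then show ?case using assms(3) REFL by (auto simp: refl_on_def)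
  next
    case (insert x B)
    then obtain m where m: "m \<in> B" "\<forall>b\<in>B. (b, m) \<in> r" by auto
    have f: "x \<in> Field r" "m \<in> Field r" using insert.prems m(1) assms(3) by auto
    then consider "(x, m) \<in> r" | "(m, x) \<in> r" using TOTALS by blast
    then show ?case
    proof cases
      case 1
      then show ?thesis using m by auto
    next
      case 2
      then have "\<forall>b\<in>insert x B. (b, x) \<in> r" using m TRANS f REFL
        by (auto simp: refl_on_def dest: transD)
      then show ?thesis by auto
    qed
  qed
  then obtain m where "m \<in> A" "\<forall>b\<in>A. (b, m) \<in> r" using \<open>finite A\<close> \<open>A \<noteq> {}\<close> by blast
  then show False using assms(3,4) ANTISYM unfolding cofinal_def
    by (metis antisymD subsetD)
qed

section \<open>Bases and field-valued metrics\<close>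

lemma weight_leE:
  assumes "weight_le X lam"
  obtains \<B> where "|\<B>| \<le>o lam" "\<And>V. V \<in> \<B> \<Longrightarrow> openin X V"
    "\<And>U x. openin X U \<Longrightarrow> x \<in> U \<Longrightarrow> \<exists>V\<in>\<B>. x \<in> V \<and> V \<subseteq> U"
proof -
  obtain \<B> where "|\<B>| \<le>o lam" "\<forall>V\<in>\<B>. openin X V"
    "\<forall>U x. openin X U \<and> x \<in> U \<longrightarrow> (\<exists>V\<in>\<B>. x \<in> V \<and> V \<subseteq> U)"
    using assms unfolding weight_le_def by (elim exE conjE)
  then show thesis by (intro that[of \<B>]) auto
qed

lemma field_metric_open_ball:
  assumes d: "field_metric (topspace X) d"
    and top: "\<And>U. openin X U \<longleftrightarrow>
      U \<subseteq> topspace X \<and> (\<forall>x\<in>U. \<exists>e>0. {y \<in> topspace X. d x y < e} \<subseteq> U)"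
    and x: "x \<in> topspace X"
  shows "openin X {y \<in> topspace X. d x y < e}"
  unfolding top
proof (intro conjI ballI)
  fix y assume y: "y \<in> {y \<in> topspace X. d x y < e}"
  have "{z \<in> topspace X. d y z < e - d x y} \<subseteq> {z \<in> topspace X. d x z < e}"
  proof
    fix z assume z: "z \<in> {z \<in> topspace X. d y z < e - d x y}"
    then have "d x z \<le> d x y + d y z" using d x y unfolding field_metric_def by auto
    also have "\<dots> < e" using z by (simp add: less_diff_eq add.commute)
    finally show "z \<in> {z \<in> topspace X. d x z < e}" using z by auto
  qed
  then show "\<exists>e'>0. {z \<in> topspace X. d y z < e'} \<subseteq> {z \<in> topspace X. d x z < e}"
    using y by (intro exI[of _ "e - d x y"]) auto
qed auto

lemma field_metric_open_ball_exterior: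
  assumes d: "field_metric (topspace X) d"
    and top: "\<And>U. openin X U \<longleftrightarrow>
      U \<subseteq> topspace X \<and> (\<forall>x\<in>U. \<exists>e>0. {y \<in> topspace X. d x y < e} \<subseteq> U)"
    and x: "x \<in> topspace X"
  shows "openin X {y \<in> topspace X. e < d x y}"
  unfolding top
proof (intro conjI ballI)
  fix y assume y: "y \<in> {y \<in> topspace X. e < d x y}"
  have "{z \<in> topspace X. d y z < d x y - e} \<subseteq> {z \<in> topspace X. e < d x z}"
  proof
    fix z assume z: "z \<in> {z \<in> topspace X. d y z < d x y - e}"
    then have "d x y \<le> d x z + d z y" "d z y = d y z" using d x y unfolding field_metric_def by auto
    then show "z \<in> {z \<in> topspace X. e < d x z}" using z by auto
  qed
  then show "\<exists>e'>0. {z \<in> topspace X. d y z < e'} \<subseteq> {z \<in> topspace X. e < d x z}"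
    using y by (intro exI[of _ "d x y - e"]) auto
qed auto

section \<open>The directed set of the nets\<close>

context
  fixes lam :: "'l rel"
  assumes co: "Card_order lam" and inf: "infinite (Field lam)"
begin

lemma wo_lam: "wo_rel lam"
  using co by (simp add: wo_rel_def card_order_on_def)

lemma Field_le_lam: "|Field lam| \<le>o lam" and lam_le_Field: "lam \<le>o |Field lam|"
  using card_of_Field_ordIso[OF co] ordIso_iff_ordLeq by auto

lemma ord_zero_least: "a \<in> Field lam \<Longrightarrow> (ord_zero lam, a) \<in> lam"
  unfolding ord_zero_def by (rule wo_rel.minim_least[OF wo_lam]) auto

lemma ord_zero_in_Field: "ord_zero lam \<in> Field lam"
  unfolding ord_zero_def by (rule wo_rel.minim_in[OF wo_lam]) (use inf in auto)

lemma underS_ord_zero: "underS lam (ord_zero lam) = {}"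
proof -
  have "antisym lam" using wo_rel.ANTISYM[OF wo_lam] .
  then show ?thesis
    using ord_zero_least by (auto simp: underS_def Field_def dest!: antisymD)
qed

lemma ex_ord_one:
  obtains a where "a \<in> Field lam" "a \<noteq> ord_zero lam" "underS lam a \<subseteq> {ord_zero lam}"
proof -
  define B where "B = Field lam - {ord_zero lam}"
  define a where "a = wo_rel.minim lam B"
  have "infinite B" unfolding B_def using inf by simp
  then have B: "B \<subseteq> Field lam" "B \<noteq> {}" by (use B_def in blast, force)
  have aB: "a \<in> B" unfolding a_def by (rule wo_rel.minim_in[OF wo_lam B])
  have al: "(a, b) \<in> lam" if "b \<in> B" for b
    unfolding a_def by (rule wo_rel.minim_least[OF wo_lam B(1) that])
  have "b = ord_zero lam" if "b \<in> underS lam a" for b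
  proof (rule ccontr)
    assume "b \<noteq> ord_zero lam"
    then have "b \<in> B" using that unfolding B_def underS_def Field_def by auto
    then have "(a, b) \<in> lam" by (rule al)
    then show False using that wo_rel.ANTISYM[OF wo_lam] unfolding underS_def
      by (auto dest: antisymD)
  qed
  then show thesis using aB that[of a] unfolding B_def by blast
qed

lemma ex_Fin_hat_supp:
  assumes "finite S" and "S \<subseteq> Field lam"
  shows "\<exists>d\<in>Fin_hat lam. ord_supp lam d = S"
proof -
  obtain a where a: "a \<in> Field lam" "a \<noteq> ord_zero lam" "underS lam a \<subseteq> {ord_zero lam}"
    by (rule ex_ord_one)
  define d where "d = restrict (\<lambda>i. if i \<in> S then a else ord_zero lam) (Field lam)"
  have s: "ord_supp lam d = S" using a assms unfolding ord_supp_def d_def by auto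
  have W: "Well_order lam" using wo_lam by (simp add: wo_rel_def)
  have "ord_below lam (d i) <o ord_sum (natLeq_on 2) (ord_below lam i)" if "i \<in> Field lam" for i
    by (rule ord_below_less_two_plus[OF W, of _ "ord_zero lam"])
      (use that a underS_ord_zero in \<open>auto simp: d_def\<close>)
  then have "d \<in> Fin_hat lam"
    unfolding Fin_hat_def using s assms a ord_zero_in_Field by (auto simp: d_def)
  then show ?thesis using s by blast
qed

lemma ord_supp_mono:
  assumes "d \<in> Fin_hat lam" and "Fin_hat_le lam d d'"
  shows "ord_supp lam d \<subseteq> ord_supp lam d'"
proof
  fix i assume i: "i \<in> ord_supp lam d"
  then have "i \<in> Field lam" "d i \<noteq> ord_zero lam" unfolding ord_supp_def by auto
  moreover have "d i \<in> Field lam" using assms(1) calculation(1) unfolding Fin_hat_def by auto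
  moreover have "(d i, d' i) \<in> lam" using assms(2) calculation(1) unfolding Fin_hat_le_def by auto
  ultimately show "i \<in> ord_supp lam d'"
    using ord_zero_least[of "d i"] wo_rel.ANTISYM[OF wo_lam] unfolding ord_supp_def
    by (auto dest: antisymD)
qed

lemma Fin_hat_directed:
  assumes "d \<in> Fin_hat lam" and "d' \<in> Fin_hat lam"
  shows "\<exists>e\<in>Fin_hat lam. Fin_hat_le lam d e \<and> Fin_hat_le lam d' e"
proof -
  define e where "e = restrict (\<lambda>i. if (d i, d' i) \<in> lam then d' i else d i) (Field lam)"
  have dF: "d i \<in> Field lam" "d' i \<in> Field lam" if "i \<in> Field lam" for i
    using assms that unfolding Fin_hat_def by auto
  have "ord_supp lam e \<subseteq> ord_supp lam d \<union> ord_supp lam d'"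
    unfolding ord_supp_def e_def by auto
  moreover have "finite (ord_supp lam d \<union> ord_supp lam d')"
    using assms unfolding Fin_hat_def by auto
  ultimately have "finite (ord_supp lam e)" by (rule finite_subset)
  then have "e \<in> Fin_hat lam"
    using assms dF unfolding Fin_hat_def by (auto simp: e_def)
  moreover have "Fin_hat_le lam d e" "Fin_hat_le lam d' e"
    using dF wo_rel.TOTALS[OF wo_lam] wo_rel.REFL[OF wo_lam]
    unfolding Fin_hat_le_def e_def by (auto simp: refl_on_def)
  ultimately show ?thesis by blast
qed

lemma card_Fin_hat_le: "|Fin_hat lam| \<le>o lam"
proof -
  define g where "g d = (\<lambda>i. (i, d i)) ` ord_supp lam d" for d :: "'l \<Rightarrow> 'l"
  have "inj_on g (Fin_hat lam)"
  proof (rule inj_onI)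
    fix d d' assume d: "d \<in> Fin_hat lam" "d' \<in> Fin_hat lam" and eq: "g d = g d'"
    have mem: "(i, a) \<in> g e \<longleftrightarrow> i \<in> Field lam \<and> e i \<noteq> ord_zero lam \<and> a = e i" for i a e
      unfolding g_def ord_supp_def by auto
    have "d i = d' i" for i
    proof (cases "i \<in> Field lam")
      case True
      then show ?thesis using mem[of i _ d] mem[of i _ d'] eq by metis
    next
      case False
      then show ?thesis using d unfolding Fin_hat_def by (auto simp: PiE_def extensional_def)
    qed
    then show "d = d'" by auto
  qed
  moreover have "g ` Fin_hat lam \<subseteq> Fpow (Field lam \<times> Field lam)"
    unfolding g_def Fpow_def Fin_hat_def ord_supp_def by auto
  ultimately have "|Fin_hat lam| \<le>o |Fpow (Field lam \<times> Field lam)|"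
    using card_of_ordLeq by blast
  also have "|Fpow (Field lam \<times> Field lam)| \<le>o |Field lam \<times> Field lam|"
    by (rule card_of_Fpow_le) (use inf in \<open>auto simp: finite_cartesian_product_iff\<close>)
  also have "|Field lam \<times> Field lam| \<le>o lam"
    using card_of_Times_ordLeq_infinite_Field[OF inf Field_le_lam Field_le_lam co] .
  finally show ?thesis .
qed

section \<open>Borel sets\<close>

lemma finite_le_lam: "finite A \<Longrightarrow> |A| \<le>o lam"
proof -
  assume "finite A"
  then have "|A| \<le>o |Field lam|" using inf by (rule finite_card_of_le_infinite)
  then show ?thesis using Field_le_lam ordLeq_transitive by blast
qed

lemma lam_borel_UN:
  assumes "|I| \<le>o lam" and "\<And>i. i \<in> I \<Longrightarrow> A i \<in> lam_borel lam X"
  shows "(\<Union>i\<in>I. A i) \<in> lam_borel lam X"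
proof (rule lam_borel_Union)
  show "|A ` I| \<le>o lam" by (rule ordLeq_transitive[OF card_of_image assms(1)])
qed (use assms(2) in auto)

lemma lam_borel_sub: "A \<in> lam_borel lam X \<Longrightarrow> A \<subseteq> topspace X"
  by (induction rule: lam_borel.induct) (auto dest: openin_subset)

lemma lam_borel_INT:
  assumes "|I| \<le>o lam" and "\<And>i. i \<in> I \<Longrightarrow> A i \<in> lam_borel lam X"
  shows "{x \<in> topspace X. \<forall>i\<in>I. x \<in> A i} \<in> lam_borel lam X"
proof -
  have "{x \<in> topspace X. \<forall>i\<in>I. x \<in> A i} = topspace X - (\<Union>i\<in>I. topspace X - A i)" by auto
  moreover have "topspace X - (\<Union>i\<in>I. topspace X - A i) \<in> lam_borel lam X"
    using assms by (intro lam_borel_compl lam_borel_UN)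
  ultimately show ?thesis by simp
qed

lemma lam_borel_Diff:
  assumes "A \<in> lam_borel lam X" and "B \<in> lam_borel lam X"
  shows "A - B \<in> lam_borel lam X"
proof -
  have "A - B = {x \<in> topspace X. \<forall>i\<in>{A, topspace X - B}. x \<in> i}"
    using lam_borel_sub[OF assms(1)] by auto
  also have "\<dots> \<in> lam_borel lam X"
    by (rule lam_borel_INT[OF finite_le_lam]) (use assms in \<open>auto intro: lam_borel_compl\<close>)
  finally show ?thesis .
qed

section \<open>Limits are Borel\<close>

lemma net_closure_borel:
  fixes X :: "'a topology" and Y :: "'b topology"
  assumes w: "weight_le Y lam" and reg: "regular_space Y"
    and f: "f \<in> net_closure X Y (Fin_hat lam) (Fin_hat_le lam) (continuous_functions X Y)"
  shows "f \<in> topspace X \<rightarrow>\<^sub>E topspace Y \<and> lam_borel_measurable lam X Y f"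
  using f
proof (induction rule: net_closure.induct)
  case (net_closure_base f)
  then show ?case unfolding continuous_functions_def lam_borel_measurable_def
    by (auto intro!: lam_borel_open openin_continuous_map_preimage)
next
  case (net_closure_lim fs f)
  let ?D = "Fin_hat lam"
  obtain \<B> where \<B>: "|\<B>| \<le>o lam" "\<And>V. V \<in> \<B> \<Longrightarrow> openin Y V"
    "\<And>U x. openin Y U \<Longrightarrow> x \<in> U \<Longrightarrow> \<exists>V\<in>\<B>. x \<in> V \<and> V \<subseteq> U"
    using weight_leE[OF w] by metis
  have lim: "\<exists>d\<in>?D. \<forall>d'\<in>?D. Fin_hat_le lam d d' \<longrightarrow> fs d' x \<in> U"
    if "x \<in> topspace X" "openin Y U" "f x \<in> U" for x U
    using net_closure_lim.hyps(3) that unfolding pointwise_lim_def by blast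
  have "{x \<in> topspace X. f x \<in> U} \<in> lam_borel lam X" if U: "openin Y U" for U
  proof -
    define \<C> where "\<C> = {V \<in> \<B>. Y closure_of V \<subseteq> U}"
    have "|\<C>| \<le>o |\<B>|" unfolding \<C>_def by (rule card_of_mono1) auto
    then have c\<C>: "|\<C>| \<le>o lam" using \<B>(1) ordLeq_transitive by blast
    define P where "P V d = {x \<in> topspace X. \<forall>d'\<in>{d' \<in> ?D. Fin_hat_le lam d d'}.
      x \<in> {x \<in> topspace X. fs d' x \<in> V}}" for V d
    have "{x \<in> topspace X. f x \<in> U} = (\<Union>V\<in>\<C>. \<Union>d\<in>?D. P V d)"
    proof (intro equalityI subsetI)
      fix x assume "x \<in> {x \<in> topspace X. f x \<in> U}"
      then have x: "x \<in> topspace X" "f x \<in> U" by auto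
      have "\<exists>W C. openin Y W \<and> closedin Y C \<and> f x \<in> W \<and> W \<subseteq> C \<and> C \<subseteq> U"
        using reg U x(2) unfolding neighbourhood_base_of_closedin[symmetric] neighbourhood_base_of
        by blast
      then obtain W C where W: "openin Y W" "closedin Y C" "f x \<in> W" "W \<subseteq> C" "C \<subseteq> U"
        by blast
      then obtain V where V: "V \<in> \<B>" "f x \<in> V" "V \<subseteq> W" using \<B>(3) by blast
      have "Y closure_of V \<subseteq> U" using W V(3) closure_of_minimal by (metis order_trans)
      then have "V \<in> \<C>" using V unfolding \<C>_def by auto
      moreover have "\<exists>d\<in>?D. x \<in> P V d"
        using lim[OF x(1) \<B>(2)[OF V(1)] V(2)] x(1) unfolding P_def by auto
      ultimately show "x \<in> (\<Union>V\<in>\<C>. \<Union>d\<in>?D. P V d)" by blast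
    next
      fix x assume "x \<in> (\<Union>V\<in>\<C>. \<Union>d\<in>?D. P V d)"
      then obtain V d where V: "V \<in> \<C>" and d: "d \<in> ?D" and x: "x \<in> topspace X"
        and ev: "\<And>d'. d' \<in> ?D \<Longrightarrow> Fin_hat_le lam d d' \<Longrightarrow> fs d' x \<in> V"
        unfolding P_def by auto
      have "f x \<in> topspace Y" using net_closure_lim.hyps(2) x by auto
      have "f x \<in> Y closure_of V"
        unfolding in_closure_of
      proof (intro conjI allI impI)
        fix T assume "f x \<in> T \<and> openin Y T"
        then have "\<exists>d\<in>?D. \<forall>d'\<in>?D. Fin_hat_le lam d d' \<longrightarrow> fs d' x \<in> T"
          using lim[OF x, of T] by simp
        then obtain d1 where d1: "d1 \<in> ?D" "\<forall>d'\<in>?D. Fin_hat_le lam d1 d' \<longrightarrow> fs d' x \<in> T"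
          by (elim bexE)
        obtain e where "e \<in> ?D" "Fin_hat_le lam d e" "Fin_hat_le lam d1 e"
          using Fin_hat_directed[OF d d1(1)] by blast
        then show "\<exists>y. y \<in> V \<and> y \<in> T" using ev d1(2) by blast
      qed fact
      then show "x \<in> {x \<in> topspace X. f x \<in> U}" using V x unfolding \<C>_def by auto
    qed
    moreover have "P V d \<in> lam_borel lam X" if "V \<in> \<C>" for V d
      unfolding P_def
    proof (rule lam_borel_INT)
      have "|{d' \<in> ?D. Fin_hat_le lam d d'}| \<le>o |?D|" by (rule card_of_mono1) auto
      then show "|{d' \<in> ?D. Fin_hat_le lam d d'}| \<le>o lam"
        using card_Fin_hat_le ordLeq_transitive by blast
    next
      fix d' assume "d' \<in> {d' \<in> ?D. Fin_hat_le lam d d'}"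
      then show "{x \<in> topspace X. fs d' x \<in> V} \<in> lam_borel lam X"
        using net_closure_lim.IH \<B>(2) that unfolding lam_borel_measurable_def \<C>_def by auto
    qed
    ultimately show ?thesis using c\<C> card_Fin_hat_le by (auto intro!: lam_borel_UN)
  qed
  then show ?case using net_closure_lim.hyps(2) unfolding lam_borel_measurable_def by auto
qed

section \<open>Borel functions are limits\<close>

context
  fixes X :: "'a topology" and Y :: "'b topology" and F :: "('a \<Rightarrow> 'b) set"
  defines "F \<equiv> net_closure X Y (Fin_hat lam) (Fin_hat_le lam) (continuous_functions X Y)"
begin

lemma closure_funcset: "h \<in> F \<Longrightarrow> h \<in> topspace X \<rightarrow>\<^sub>E topspace Y"
  unfolding F_def by (erule net_closure.cases) (simp_all add: continuous_functions_def)

lemma closure_lim_finite_subsets: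
  assumes I: "|I| \<le>o lam"
    and g: "\<And>S. finite S \<Longrightarrow> S \<subseteq> I \<Longrightarrow> g S \<in> F"
    and h: "h \<in> topspace X \<rightarrow>\<^sub>E topspace Y"
    and lim: "\<And>x U. x \<in> topspace X \<Longrightarrow> openin Y U \<Longrightarrow> h x \<in> U \<Longrightarrow>
      \<exists>R. finite R \<and> R \<subseteq> I \<and> (\<forall>S. finite S \<longrightarrow> S \<subseteq> I \<longrightarrow> R \<subseteq> S \<longrightarrow> g S x \<in> U)"
  shows "h \<in> F"
proof -
  have "|I| \<le>o |Field lam|" using I lam_le_Field ordLeq_transitive by blast
  then obtain \<phi> where \<phi>: "inj_on \<phi> I" "\<phi> ` I \<subseteq> Field lam"
    unfolding card_of_ordLeq[symmetric] by blast
  define T where "T d = {i \<in> I. \<phi> i \<in> ord_supp lam d}" for d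
  have T: "finite (T d)" "T d \<subseteq> I" if "d \<in> Fin_hat lam" for d
  proof -
    have "finite (ord_supp lam d)" using that unfolding Fin_hat_def by auto
    moreover have "\<phi> ` T d \<subseteq> ord_supp lam d" "inj_on \<phi> (T d)"
      using \<phi>(1) unfolding T_def by (auto simp: inj_on_def)
    ultimately show "finite (T d)" using inj_on_finite by blast
  qed (auto simp: T_def)
  show ?thesis
    unfolding F_def
  proof (rule net_closure_lim[where fs = "\<lambda>d. g (T d)"])
    show "g (T d) \<in> net_closure X Y (Fin_hat lam) (Fin_hat_le lam) (continuous_functions X Y)"
      if "d \<in> Fin_hat lam" for d
      using g[OF T[OF that]] unfolding F_def .
    show "h \<in> topspace X \<rightarrow>\<^sub>E topspace Y" by fact
    show "pointwise_lim X Y (Fin_hat lam) (Fin_hat_le lam) (\<lambda>d. g (T d)) h"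
      unfolding pointwise_lim_def
    proof (intro ballI allI impI)
      fix x U assume "x \<in> topspace X" "openin Y U \<and> h x \<in> U"
      then have "\<exists>R. finite R \<and> R \<subseteq> I \<and> (\<forall>S. finite S \<longrightarrow> S \<subseteq> I \<longrightarrow> R \<subseteq> S \<longrightarrow> g S x \<in> U)"
        using lim[of x U] by simp
      then obtain R where R: "finite R" "R \<subseteq> I"
        "\<And>S. finite S \<Longrightarrow> S \<subseteq> I \<Longrightarrow> R \<subseteq> S \<Longrightarrow> g S x \<in> U"
        by (elim exE conjE) auto
      obtain d where d: "d \<in> Fin_hat lam" "ord_supp lam d = \<phi> ` R"
        using ex_Fin_hat_supp[of "\<phi> ` R"] R(1,2) \<phi>(2) by (meson finite_imageI image_mono order_trans)
      have "g (T d') x \<in> U" if d': "d' \<in> Fin_hat lam" "Fin_hat_le lam d d'" for d'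
      proof (rule R(3)[OF T[OF d'(1)]])
        show "R \<subseteq> T d'" using ord_supp_mono[OF d(1) d'(2)] d(2) R(2) unfolding T_def by auto
      qed
      then show "\<exists>d\<in>Fin_hat lam. \<forall>d'\<in>Fin_hat lam. Fin_hat_le lam d d' \<longrightarrow> g (T d') x \<in> U"
        using d(1) by blast
    qed
  qed
qed

lemma closure_const:
  assumes "y \<in> topspace Y"
  shows "restrict (\<lambda>_. y) (topspace X) \<in> F"
  unfolding F_def
  by (rule net_closure_base) (use assms in \<open>auto simp: continuous_functions_def
      intro: continuous_map_eq[of X Y "\<lambda>_. y"]\<close>)

definition glue :: "'a set \<Rightarrow> ('a \<Rightarrow> 'b) \<Rightarrow> ('a \<Rightarrow> 'b) \<Rightarrow> 'a \<Rightarrow> 'b" where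
  "glue A h k = (\<lambda>x. if x \<in> A then h x else k x)"

definition good :: "'a set \<Rightarrow> bool" where
  "good A \<longleftrightarrow> (\<forall>h\<in>F. \<forall>k\<in>F. glue A h k \<in> F)"

lemma glue_funcset:
  "h \<in> topspace X \<rightarrow>\<^sub>E topspace Y \<Longrightarrow> k \<in> topspace X \<rightarrow>\<^sub>E topspace Y \<Longrightarrow>
    glue A h k \<in> topspace X \<rightarrow>\<^sub>E topspace Y"
  unfolding glue_def by (auto simp: PiE_def extensional_def)

lemma pointwise_lim_glue_const:
  assumes "pointwise_lim X Y (Fin_hat lam) (Fin_hat_le lam) fs h"
  shows "pointwise_lim X Y (Fin_hat lam) (Fin_hat_le lam) (\<lambda>d. glue A (fs d) k) (glue A h k)"
proof -
  obtain d0 where "d0 \<in> Fin_hat lam" using ex_Fin_hat_supp[of "{}"] by auto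
  then show ?thesis using assms unfolding pointwise_lim_def glue_def by auto
qed

lemma glue_compl:
  assumes "h \<in> topspace X \<rightarrow>\<^sub>E topspace Y" and "k \<in> topspace X \<rightarrow>\<^sub>E topspace Y"
  shows "glue (topspace X - A) h k = glue A k h"
proof
  fix x
  show "glue (topspace X - A) h k x = glue A k h x"
    using assms by (cases "x \<in> topspace X") (auto simp: glue_def PiE_def extensional_def)
qed

lemma good_compl: "good A \<Longrightarrow> good (topspace X - A)"
  unfolding good_def by (simp add: glue_compl closure_funcset)

lemma continuous_glue:
  assumes A: "openin X A" "closedin X A"
    and h: "h \<in> continuous_functions X Y" and k: "k \<in> continuous_functions X Y"
  shows "glue A h k \<in> continuous_functions X Y"
proof -
  have *: "{x \<in> topspace X. glue A h k x \<in> U} =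
    (A \<inter> {x \<in> topspace X. h x \<in> U}) \<union> ((topspace X - A) \<inter> {x \<in> topspace X. k x \<in> U})" for U
    unfolding glue_def by auto
  have "openin X {x \<in> topspace X. glue A h k x \<in> U}" if "openin Y U" for U
    unfolding * using h k A that unfolding continuous_functions_def
    by (intro openin_Un openin_Int openin_diff) (auto intro: openin_continuous_map_preimage)
  moreover have "glue A h k \<in> topspace X \<rightarrow>\<^sub>E topspace Y"
    using h k unfolding continuous_functions_def by (intro glue_funcset) auto
  ultimately show ?thesis unfolding continuous_functions_def continuous_map_def by auto
qed

lemma good_clopen:
  assumes A: "openin X A" "closedin X A"
  shows "good A"
proof -
  have 1: "glue B h k \<in> F" if B: "openin X B" "closedin X B" and "h \<in> F"
    and k: "k \<in> continuous_functions X Y" for B h k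
    using that(3) unfolding F_def
  proof (induction rule: net_closure.induct)
    case (net_closure_base f)
    then show ?case by (intro net_closure.net_closure_base continuous_glue[OF B _ k])
  next
    case (net_closure_lim fs f)
    have "k \<in> topspace X \<rightarrow>\<^sub>E topspace Y" using k by (simp add: continuous_functions_def)
    then show ?case
      using net_closure_lim.hyps(2)
      by (intro net_closure.net_closure_lim[OF net_closure_lim.IH _
            pointwise_lim_glue_const[OF net_closure_lim.hyps(3)]] glue_funcset)
  qed
  have "glue (topspace X - A) k h \<in> F" if "h \<in> F" "k \<in> F" for h k
    using that(2) unfolding F_def
  proof (induction rule: net_closure.induct)
    case (net_closure_base f)
    have "glue A h f \<in> F" using 1[OF A that(1) net_closure_base] .
    moreover have "glue (topspace X - A) f h = glue A h f"
      using closure_funcset[OF that(1)] net_closure_base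
      by (intro glue_compl) (auto simp: continuous_functions_def)
    ultimately show ?case unfolding F_def by simp
  next
    case (net_closure_lim fs f)
    then show ?case
      using closure_funcset[OF that(1)]
      by (intro net_closure.net_closure_lim[OF net_closure_lim.IH _
            pointwise_lim_glue_const[OF net_closure_lim.hyps(3)]] glue_funcset)
  qed
  then show ?thesis unfolding good_def by (simp add: glue_compl closure_funcset)
qed

lemma good_Union_finite:
  assumes "finite \<A>" and "\<And>A. A \<in> \<A> \<Longrightarrow> good A"
  shows "good (\<Union>\<A>)"
  using assms
proof (induction rule: finite_induct)
  case empty
  show ?case unfolding good_def glue_def by simp
next
  case (insert A \<A>)
  have "glue (\<Union>(insert A \<A>)) h k = glue A h (glue (\<Union>\<A>) h k)" for h k
    unfolding glue_def by auto
  then show ?case using insert unfolding good_def by simp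
qed

lemma good_Union:
  assumes "|\<A>| \<le>o lam" and "\<And>A. A \<in> \<A> \<Longrightarrow> good A"
  shows "good (\<Union>\<A>)"
  unfolding good_def
proof (intro ballI)
  fix h k assume hk: "h \<in> F" "k \<in> F"
  show "glue (\<Union>\<A>) h k \<in> F"
  proof (rule closure_lim_finite_subsets[OF assms(1), where g = "\<lambda>S. glue (\<Union>S) h k"])
    show "glue (\<Union>S) h k \<in> F" if "finite S" "S \<subseteq> \<A>" for S
      using good_Union_finite[of S] that assms(2) hk unfolding good_def by blast
    show "glue (\<Union>\<A>) h k \<in> topspace X \<rightarrow>\<^sub>E topspace Y"
      using hk by (intro closure_funcset glue_funcset)
    fix x U assume x: "glue (\<Union>\<A>) h k x \<in> U"
    show "\<exists>R. finite R \<and> R \<subseteq> \<A> \<and>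
      (\<forall>S. finite S \<longrightarrow> S \<subseteq> \<A> \<longrightarrow> R \<subseteq> S \<longrightarrow> glue (\<Union>S) h k x \<in> U)"
    proof (cases "x \<in> \<Union>\<A>")
      case True
      then obtain A where "A \<in> \<A>" "x \<in> A" by blast
      moreover from this have "h x \<in> U" using x by (auto simp: glue_def split: if_splits)
      ultimately show ?thesis by (intro exI[of _ "{A}"]) (auto simp: glue_def)
    next
      case False
      moreover from this have "k x \<in> U" using x by (auto simp: glue_def split: if_splits)
      ultimately show ?thesis by (intro exI[of _ "{}"]) (auto simp: glue_def)
    qed
  qed
qed

context
  assumes clopen_base: "\<And>U x. openin X U \<Longrightarrow> x \<in> U \<Longrightarrow>
      \<exists>C. openin X C \<and> closedin X C \<and> x \<in> C \<and> C \<subseteq> U"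
    and wX: "weight_le X lam"
begin

lemma good_open:
  assumes U: "openin X U"
  shows "good U"
proof -
  obtain \<B> where \<B>: "|\<B>| \<le>o lam" "\<And>U x. openin X U \<Longrightarrow> x \<in> U \<Longrightarrow> \<exists>V\<in>\<B>. x \<in> V \<and> V \<subseteq> U"
    using weight_leE[OF wX] by metis
  define P where "P V C \<longleftrightarrow> openin X C \<and> closedin X C \<and> V \<subseteq> C \<and> C \<subseteq> U" for V C
  define \<C> where "\<C> = {V \<in> \<B>. \<exists>C. P V C}"
  obtain c where c: "\<And>V. V \<in> \<C> \<Longrightarrow> P V (c V)" 
    using bchoice[of \<C> P] unfolding \<C>_def by auto
  have "U = \<Union>(c ` \<C>)"
  proof (intro equalityI subsetI)
    fix x assume "x \<in> U"
    then obtain C where C: "openin X C" "closedin X C" "x \<in> C" "C \<subseteq> U"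
      using clopen_base U by blast
    then obtain V where "V \<in> \<B>" "x \<in> V" "V \<subseteq> C" using \<B>(2) by blast
    moreover from this C have "V \<in> \<C>" unfolding \<C>_def P_def by blast
    ultimately show "x \<in> \<Union>(c ` \<C>)" using c unfolding P_def by blast
  qed (use c in \<open>auto simp: P_def\<close>)
  moreover have "|c ` \<C>| \<le>o lam"
  proof -
    have "|\<C>| \<le>o |\<B>|" unfolding \<C>_def by (rule card_of_mono1) auto
    then show ?thesis using \<B>(1) card_of_image ordLeq_transitive by blast
  qed
  then have "good (\<Union>(c ` \<C>))"
    by (rule good_Union) (use c in \<open>auto simp: P_def intro: good_clopen\<close>)
  ultimately show ?thesis by simp
qed

lemma good_borel: "A \<in> lam_borel lam X \<Longrightarrow> good A"
  by (induction rule: lam_borel.induct) (auto intro: good_open good_compl good_Union)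

lemma closure_piecewise_const:
  assumes I: "|I| \<le>o lam"
    and P: "\<And>i. i \<in> I \<Longrightarrow> P i \<in> lam_borel lam X"
    and y: "\<And>i. i \<in> I \<Longrightarrow> y i \<in> topspace Y"
    and disj: "\<And>i j x. i \<in> I \<Longrightarrow> j \<in> I \<Longrightarrow> x \<in> P i \<Longrightarrow> x \<in> P j \<Longrightarrow> i = j"
    and cover: "\<And>x. x \<in> topspace X \<Longrightarrow> \<exists>i\<in>I. x \<in> P i"
  shows "restrict (\<lambda>x. y (THE i. i \<in> I \<and> x \<in> P i)) (topspace X) \<in> F"
proof (cases "topspace X = {}")
  case True
  then have "restrict (\<lambda>x. y (THE i. i \<in> I \<and> x \<in> P i)) (topspace X) \<in> continuous_functions X Y"
    unfolding continuous_functions_def continuous_map_def by auto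
  then show ?thesis unfolding F_def by (rule net_closure_base)
next
  case False
  then obtain y0 where y0: "y0 \<in> topspace Y" using cover y by blast
  define \<iota> where "\<iota> x = (THE i. i \<in> I \<and> x \<in> P i)" for x
  have \<iota>: "\<iota> x = i" if "i \<in> I" "x \<in> P i" for x i
    unfolding \<iota>_def using that disj by (intro the_equality) auto
  have \<iota>_in: "\<iota> x \<in> I" if "x \<in> topspace X" for x
    using cover[OF that] \<iota> by auto
  define g where "g S = restrict (\<lambda>x. if \<iota> x \<in> S then y (\<iota> x) else y0) (topspace X)" for S
  have gF: "g S \<in> F" if "finite S" "S \<subseteq> I" for S
    using that
  proof (induction rule: finite_induct)
    case empty
    show ?case unfolding g_def using closure_const[OF y0] by (simp add: restrict_def)
  next
    case (insert i S)
    have "g (insert i S) = glue (P i) (restrict (\<lambda>_. y i) (topspace X)) (g S)"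
    proof
      fix x
      show "g (insert i S) x = glue (P i) (restrict (\<lambda>_. y i) (topspace X)) (g S) x"
      proof (cases "x \<in> topspace X")
        case True
        then obtain j where "j \<in> I" "x \<in> P j" using cover by blast
        then show ?thesis using True \<iota>[of j x] disj[of i j x] insert.prems
          unfolding g_def glue_def by auto
      qed (auto simp: g_def glue_def)
    qed
    moreover have "good (P i)" using insert.prems P good_borel by blast
    moreover have "restrict (\<lambda>_. y i) (topspace X) \<in> F" using insert.prems y closure_const by blast
    ultimately show ?case using insert unfolding good_def by simp
  qed
  have "restrict (\<lambda>x. y (\<iota> x)) (topspace X) \<in> F"
  proof (rule closure_lim_finite_subsets[OF I, of g])
    show "restrict (\<lambda>x. y (\<iota> x)) (topspace X) \<in> topspace X \<rightarrow>\<^sub>E topspace Y"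
      using y \<iota>_in by auto
    fix x U assume "x \<in> topspace X" "restrict (\<lambda>x. y (\<iota> x)) (topspace X) x \<in> U"
    then show "\<exists>R. finite R \<and> R \<subseteq> I \<and> (\<forall>S. finite S \<longrightarrow> S \<subseteq> I \<longrightarrow> R \<subseteq> S \<longrightarrow> g S x \<in> U)"
      using \<iota>_in by (intro exI[of _ "{\<iota> x}"]) (auto simp: g_def)
  qed (use gF in auto)
  then show ?thesis unfolding \<iota>_def .
qed

lemma borel_function_in_closure:
  fixes d :: "'b \<Rightarrow> 'b \<Rightarrow> 'g::linordered_field" and A :: "'g set"
  assumes d: "field_metric (topspace Y) d"
    and top: "\<And>U. openin Y U \<longleftrightarrow>
      U \<subseteq> topspace Y \<and> (\<forall>x\<in>U. \<exists>e>0. {y \<in> topspace Y. d x y < e} \<subseteq> U)"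
    and wY: "weight_le Y lam"
    and A: "A \<subseteq> {0<..}" "\<And>g. g > 0 \<Longrightarrow> \<exists>a\<in>A. a \<le> g" "|A| \<le>o lam"
    and f: "f \<in> topspace X \<rightarrow>\<^sub>E topspace Y" "lam_borel_measurable lam X Y f"
  shows "f \<in> F"
proof -
  have sym: "d x y = d y x" and self: "d x x = 0" if "x \<in> topspace Y" "y \<in> topspace Y" for x y
    using d that unfolding field_metric_def by auto
  have ball: "openin Y {z \<in> topspace Y. d y z < e}" if y: "y \<in> topspace Y" for y e
    using field_metric_open_ball[OF d top y] .
  obtain \<B> where \<B>: "|\<B>| \<le>o lam" "\<And>V. V \<in> \<B> \<Longrightarrow> openin Y V"
    "\<And>U x. openin Y U \<Longrightarrow> x \<in> U \<Longrightarrow> \<exists>V\<in>\<B>. x \<in> V \<and> V \<subseteq> U"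
    using weight_leE[OF wY] by metis
  have "|\<B>| \<le>o |Field lam|" using \<B>(1) lam_le_Field ordLeq_transitive by blast
  then obtain \<phi> where \<phi>: "inj_on \<phi> \<B>" "\<phi> ` \<B> \<subseteq> Field lam"
    unfolding card_of_ordLeq[symmetric] by blast
  have wf: "wf (lam - Id)" using wo_rel.WF[OF wo_lam] .
  have fY: "f x \<in> topspace Y" if "x \<in> topspace X" for x using f(1) that by auto
  have "\<exists>h\<in>F. \<forall>x\<in>topspace X. d (f x) (h x) < a" if a: "a > 0" for a
  proof -
    define I where "I = {V \<in> \<B>. \<exists>y\<in>topspace Y. V \<subseteq> {z \<in> topspace Y. d y z < a}}"
    have "\<exists>y. \<forall>V\<in>I. y V \<in> topspace Y \<and> V \<subseteq> {z \<in> topspace Y. d (y V) z < a}"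
      unfolding I_def by (intro bchoice) auto
    then obtain y where y: "\<And>V. V \<in> I \<Longrightarrow> y V \<in> topspace Y"
      "\<And>V. V \<in> I \<Longrightarrow> V \<subseteq> {z \<in> topspace Y. d (y V) z < a}"
      by blast
    have "|I| \<le>o |\<B>|" unfolding I_def by (rule card_of_mono1) auto
    then have cI: "|I| \<le>o lam" using \<B>(1) ordLeq_transitive by blast
    define pre where "pre V = {x \<in> topspace X. f x \<in> V}" for V
    define bel where "bel V = {W \<in> I. (\<phi> W, \<phi> V) \<in> lam - Id}" for V
    define P where "P V = pre V - (\<Union>W\<in>bel V. pre W)" for V
    have pre: "pre V \<in> lam_borel lam X" if "V \<in> I" for V
      using f(2) \<B>(2) that unfolding pre_def I_def lam_borel_measurable_def by auto
    have "P V \<in> lam_borel lam X" if "V \<in> I" for V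
    proof -
      have "|bel V| \<le>o |I|" unfolding bel_def by (rule card_of_mono1) auto
      then have "|bel V| \<le>o lam" using cI ordLeq_transitive by blast
      then have "(\<Union>W\<in>bel V. pre W) \<in> lam_borel lam X"
        by (rule lam_borel_UN) (auto simp: bel_def intro: pre)
      then show ?thesis unfolding P_def using pre[OF that] lam_borel_Diff by blast
    qed
    moreover have disj: "V = W" if "V \<in> I" "W \<in> I" "x \<in> P V" "x \<in> P W" for V W x
    proof (rule ccontr)
      assume "V \<noteq> W"
      have "V \<in> \<B>" "W \<in> \<B>" using that unfolding I_def by auto
      then have "\<phi> V \<noteq> \<phi> W" "\<phi> V \<in> Field lam" "\<phi> W \<in> Field lam"
        using \<phi> \<open>V \<noteq> W\<close> by (auto dest: inj_onD)
      then have "V \<in> bel W \<or> W \<in> bel V"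
        using that wo_rel.TOTALS[OF wo_lam] unfolding bel_def by auto
      then show False using that unfolding P_def by auto
    qed
    moreover have cover: "\<exists>V\<in>I. x \<in> P V" if x: "x \<in> topspace X" for x
    proof -
      have "f x \<in> {z \<in> topspace Y. d (f x) z < a}" using self fY[OF x] a by auto
      then obtain V where "V \<in> \<B>" "f x \<in> V" "V \<subseteq> {z \<in> topspace Y. d (f x) z < a}"
        using \<B>(3)[OF ball] fY[OF x] by blast
      then have "V \<in> {V \<in> I. f x \<in> V}" unfolding I_def using fY[OF x] by auto
      then have "\<phi> V \<in> \<phi> ` {V \<in> I. f x \<in> V}" by (rule imageI)
      then obtain m where "m \<in> \<phi> ` {V \<in> I. f x \<in> V}"
        and min: "\<And>n. (n, m) \<in> lam - Id \<Longrightarrow> n \<notin> \<phi> ` {V \<in> I. f x \<in> V}"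
        by (rule wfE_min[OF wf]) blast
      then obtain W where W: "W \<in> I" "f x \<in> W" "m = \<phi> W" by auto
      have "x \<in> P W" using W x min unfolding P_def pre_def bel_def by auto
      then show ?thesis using W by blast
    qed
    ultimately have hF: "restrict (\<lambda>x. y (THE V. V \<in> I \<and> x \<in> P V)) (topspace X) \<in> F"
      using closure_piecewise_const[OF cI, of P y] y(1) by blast
    have "d (f x) (y (THE V. V \<in> I \<and> x \<in> P V)) < a" if x: "x \<in> topspace X" for x
    proof -
      obtain V where V: "V \<in> I" "x \<in> P V" using cover[OF x] by blast
      then have "(THE V. V \<in> I \<and> x \<in> P V) = V" using disj by (intro the_equality) auto
      moreover have "d (y V) (f x) < a" using V y(2)[OF V(1)] unfolding P_def pre_def by auto
      ultimately show ?thesis using sym[OF y(1)[OF V(1)] fY[OF x]] by simp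
    qed
    then show ?thesis by (intro bexI[OF _ hF]) auto
  qed
  then obtain h where h: "\<And>a. a > 0 \<Longrightarrow> h a \<in> F"
    "\<And>a x. a > 0 \<Longrightarrow> x \<in> topspace X \<Longrightarrow> d (f x) (h a x) < a"
    by metis
  show ?thesis
  proof (rule closure_lim_finite_subsets[OF A(3), where g = "\<lambda>S. h (Min (insert 1 S))"])
    have pos: "Min (insert 1 S) > 0" if "finite S" "S \<subseteq> A" for S
      using that A(1) by auto
    then show "h (Min (insert 1 S)) \<in> F" if "finite S" "S \<subseteq> A" for S
      using h(1) that by blast
    fix x U assume x: "x \<in> topspace X" and U: "openin Y U" "f x \<in> U"
    then obtain e where e: "e > 0" "{y \<in> topspace Y. d (f x) y < e} \<subseteq> U"
      unfolding top by blast
    then obtain a where a: "a \<in> A" "a \<le> e" using A(2) by blast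
    have "h (Min (insert 1 S)) x \<in> U" if S: "finite S" "S \<subseteq> A" "{a} \<subseteq> S" for S
    proof -
      have "d (f x) (h (Min (insert 1 S)) x) < Min (insert 1 S)" using h(2) pos S x by blast
      also have "\<dots> \<le> a" using S by (intro Min_le) auto
      finally have "d (f x) (h (Min (insert 1 S)) x) < e" using a by simp
      moreover have "h (Min (insert 1 S)) x \<in> topspace Y"
        using closure_funcset[OF h(1)[OF pos[OF S(1,2)]]] x by auto
      ultimately show ?thesis using e by auto
    qed
    then show "\<exists>R. finite R \<and> R \<subseteq> A \<and>
      (\<forall>S. finite S \<longrightarrow> S \<subseteq> A \<longrightarrow> R \<subseteq> S \<longrightarrow> h (Min (insert 1 S)) x \<in> U)"
      using a by (intro exI[of _ "{a}"]) auto
  qed (use f in auto)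
qed

end

end

end

section \<open>Metrizable spaces\<close>

lemma field_metrizable_real:
  assumes "metrizable_space X"
  shows "field_metrizable TYPE(real) X"
proof -
  obtain M d where M: "Metric_space M d" "X = Metric_space.mtopology M d"
    using assms unfolding metrizable_space_def by blast
  interpret Metric_space M d by fact
  have "field_metric (topspace X) d"
    unfolding field_metric_def M(2) using commute triangle by auto
  moreover have "openin X U \<longleftrightarrow>
      U \<subseteq> topspace X \<and> (\<forall>x\<in>U. \<exists>e>0. {y \<in> topspace X. d x y < e} \<subseteq> U)" for U
  proof -
    have "mball x e = {y \<in> M. d x y < e}" if "x \<in> M" for x e
      using that by (auto simp: in_mball)
    then show ?thesis unfolding M(2) openin_mtopology topspace_mtopology by (metis subsetD)
  qed
  ultimately show ?thesis unfolding field_metrizable_def by blast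
qed

lemma field_metrizable_regular:
  fixes X :: "'a topology"
  assumes "field_metrizable TYPE('g::linordered_field) X"
  shows "regular_space X"
proof -
  obtain d :: "'a \<Rightarrow> 'a \<Rightarrow> 'g" where d: "field_metric (topspace X) d"
    and top: "\<And>U. openin X U \<longleftrightarrow>
      U \<subseteq> topspace X \<and> (\<forall>x\<in>U. \<exists>e>0. {y \<in> topspace X. d x y < e} \<subseteq> U)"
    using assms unfolding field_metrizable_def by blast
  show ?thesis
    unfolding regular_space_def
  proof (intro allI impI)
    fix C a assume "closedin X C \<and> a \<in> topspace X - C"
    then have C: "closedin X C" and a: "a \<in> topspace X" "a \<notin> C" by auto
    have "openin X (topspace X - C)" using C by blast
    then obtain e where e: "e > 0" "{y \<in> topspace X. d a y < e} \<subseteq> topspace X - C"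
      using a unfolding top[of "topspace X - C"] by blast
    have "d a a = 0" using d a(1) unfolding field_metric_def by auto
    then have "a \<in> {y \<in> topspace X. d a y < e / 2}" using a e by auto
    moreover have "C \<subseteq> {y \<in> topspace X. e / 2 < d a y}"
    proof
      fix y assume y: "y \<in> C"
      then have "y \<in> topspace X" using C closedin_subset by blast
      moreover have "e \<le> d a y" using e(2) y calculation by (auto simp: not_less[symmetric])
      then have "e / 2 < d a y" using e(1) by (simp add: field_simps)
      ultimately show "y \<in> {y \<in> topspace X. e / 2 < d a y}" by simp
    qed
    moreover have "disjnt {y \<in> topspace X. d a y < e / 2} {y \<in> topspace X. e / 2 < d a y}"
      unfolding disjnt_def by auto
    ultimately show "\<exists>U V. openin X U \<and> openin X V \<and> a \<in> U \<and> C \<subseteq> V \<and> disjnt U V"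
      using field_metric_open_ball[OF d top a(1)] field_metric_open_ball_exterior[OF d top a(1)]
      by blast
  qed
qed

lemma field_metrizable_clopen_base:
  fixes X :: "'a topology"
  assumes "field_metrizable TYPE('g::linordered_field) X"
    and coin: "has_pos_coinitiality TYPE('g) mu" and "natLeq <o mu"
    and U: "openin X U" "x \<in> U"
  shows "\<exists>C. openin X C \<and> closedin X C \<and> x \<in> C \<and> C \<subseteq> U"
proof -
  obtain d :: "'a \<Rightarrow> 'a \<Rightarrow> 'g" where d: "field_metric (topspace X) d"
    and top: "\<And>U. openin X U \<longleftrightarrow>
      U \<subseteq> topspace X \<and> (\<forall>x\<in>U. \<exists>e>0. {y \<in> topspace X. d x y < e} \<subseteq> U)"
    using assms(1) unfolding field_metrizable_def by blast
  have x: "x \<in> topspace X" using U openin_subset by blast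
  obtain e where e: "e > 0" "{y \<in> topspace X. d x y < e} \<subseteq> U" using U unfolding top by blast
  define E where "E = range (\<lambda>n::nat. e / 2 ^ n)"
  have "|E| \<le>o |UNIV :: nat set|" unfolding E_def by (rule card_of_image)
  then have "|E| <o mu"
    using assms(3) card_of_nat ordLeq_ordIso_trans ordLeq_ordLess_trans by blast
  then have "\<not> mu \<le>o |E|" using not_ordLess_ordLeq by blast
  moreover have "E \<subseteq> {0<..}" using e(1) unfolding E_def by auto
  ultimately have "\<not> (\<forall>g>0. \<exists>a\<in>E. a \<le> g)"
    using coin unfolding has_pos_coinitiality_def by blast
  then obtain \<delta> where \<delta>: "\<delta> > 0" "\<And>n. \<delta> < e / 2 ^ n" unfolding E_def by (auto simp: not_le)
  have half: "e / 2 ^ Suc n + e / 2 ^ Suc n = e / 2 ^ n" for n by (simp add: field_simps)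
  have halfless: "e / 2 ^ Suc n < e / 2 ^ n" for n
    using half[of n] e(1) by (metis less_add_same_cancel1 zero_less_divide_iff zero_less_numeral zero_less_power)
  define C where "C = {y \<in> topspace X. \<forall>n. d x y < e / 2 ^ n}"
  have "openin X C"
    unfolding top
  proof (intro conjI ballI)
    fix y assume y: "y \<in> C"
    have "z \<in> C" if z: "z \<in> topspace X" "d y z < \<delta>" for z
    proof -
      have "d x z < e / 2 ^ n" for n
      proof -
        have "d x z \<le> d x y + d y z" using d x y z unfolding C_def field_metric_def by auto
        also have "\<dots> < e / 2 ^ Suc n + e / 2 ^ Suc n"
          by (rule add_strict_mono) (use y z \<delta>(2)[of "Suc n"] in \<open>auto simp: C_def simp del: power_Suc\<close>)
        finally show ?thesis using half by simp
      qed
      then show ?thesis using z unfolding C_def by auto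
    qed
    then show "\<exists>e>0. {z \<in> topspace X. d y z < e} \<subseteq> C" using \<delta>(1) by blast
  qed (auto simp: C_def)
  moreover have "topspace X - C = (\<Union>n. {y \<in> topspace X. e / 2 ^ n < d x y})"
  proof (intro equalityI subsetI)
    fix y assume "y \<in> topspace X - C"
    then obtain n where "e / 2 ^ n \<le> d x y" "y \<in> topspace X" unfolding C_def by (auto simp: not_less)
    then have "y \<in> {y \<in> topspace X. e / 2 ^ Suc n < d x y}" using halfless[of n] by simp
    then show "y \<in> (\<Union>n. {y \<in> topspace X. e / 2 ^ n < d x y})" by blast
  next
    fix y assume "y \<in> (\<Union>n. {y \<in> topspace X. e / 2 ^ n < d x y})"
    then show "y \<in> topspace X - C" unfolding C_def by (auto dest: less_asym)
  qed
  then have "openin X (topspace X - C)"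
    using field_metric_open_ball_exterior[OF d top x] by auto
  then have "closedin X C" unfolding closedin_def C_def by auto
  moreover have "d x x = 0" using d x unfolding field_metric_def by auto
  then have "x \<in> C" using x e(1) unfolding C_def by simp
  moreover have "C \<subseteq> {y \<in> topspace X. d x y < e / 2 ^ 0}" unfolding C_def by blast
  then have "C \<subseteq> U" using e(2) by simp
  ultimately show ?thesis by blast
qed

lemma covering_dim_clopen_base:
  assumes "covering_dim_le X 0" and "t1_space X" and U: "openin X U" "x \<in> U"
  shows "\<exists>C. openin X C \<and> closedin X C \<and> x \<in> C \<and> C \<subseteq> U"
proof -
  have x: "x \<in> topspace X" using U openin_subset by blast
  have "closedin X {x}" using assms(2) x by (simp add: t1_space_closedin_singleton)
  then have o: "\<forall>W\<in>{U, topspace X - {x}}. openin X W" using U by auto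
  moreover have "\<Union>{U, topspace X - {x}} = topspace X" using U openin_subset by blast
  ultimately have "\<exists>\<V>. (\<forall>V\<in>\<V>. openin X V \<and> (\<exists>W\<in>{U, topspace X - {x}}. V \<subseteq> W)) \<and> \<Union>\<V> = topspace X \<and>
      (\<forall>x\<in>topspace X. finite {V\<in>\<V>. x \<in> V} \<and> int (card {V\<in>\<V>. x \<in> V}) \<le> 0 + 1)"
    using assms(1)[unfolded covering_dim_le_def, THEN conjunct2, THEN spec,
        of "{U, topspace X - {x}}"] by simp
  then obtain \<V> where \<V>: "\<forall>V\<in>\<V>. openin X V \<and> (\<exists>W\<in>{U, topspace X - {x}}. V \<subseteq> W)"
    "\<Union>\<V> = topspace X"
    and ord: "\<forall>x\<in>topspace X. finite {V\<in>\<V>. x \<in> V} \<and> int (card {V\<in>\<V>. x \<in> V}) \<le> 0 + 1"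
    by (elim exE conjE)
  obtain V where V: "V \<in> \<V>" "x \<in> V" using \<V>(2) x by blast
  then have "V \<subseteq> U" using \<V>(1) by blast
  have uniq: "W = V" if "W \<in> \<V>" "z \<in> W" "z \<in> V" for W z
  proof -
    have "z \<in> topspace X" using that \<V>(2) by blast
    then have "finite {V\<in>\<V>. z \<in> V}" "card {V\<in>\<V>. z \<in> V} \<le> Suc 0" using ord by auto
    moreover have "W \<in> {V\<in>\<V>. z \<in> V}" "V \<in> {V\<in>\<V>. z \<in> V}" using that V by auto
    ultimately show ?thesis using card_le_Suc0_iff_eq by blast
  qed
  have "topspace X - V = \<Union>(\<V> - {V})" using \<V>(2) uniq V by blast
  moreover have "openin X (\<Union>(\<V> - {V}))" using \<V>(1) by blast
  ultimately have "closedin X V" using \<V> V unfolding closedin_def by auto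
  then show ?thesis using \<V>(1) V \<open>V \<subseteq> U\<close> by blast
qed

lemma closure_iff_borel:
  fixes lam :: "'l rel" and X :: "'a topology" and Y :: "'b topology"
    and A :: "'g::linordered_field set"
  assumes co: "Card_order lam" and inf: "infinite (Field lam)"
    and clopen: "\<And>U x. openin X U \<Longrightarrow> x \<in> U \<Longrightarrow>
      \<exists>C. openin X C \<and> closedin X C \<and> x \<in> C \<and> C \<subseteq> U"
    and wX: "weight_le X lam"
    and Y: "field_metrizable TYPE('g) Y" and wY: "weight_le Y lam"
    and A: "A \<subseteq> {0<..}" "\<And>g. g > 0 \<Longrightarrow> \<exists>a\<in>A. a \<le> g" "|A| \<le>o lam"
    and f: "f \<in> topspace X \<rightarrow>\<^sub>E topspace Y"
  shows "lam_borel_measurable lam X Y f \<longleftrightarrow>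
    f \<in> net_closure X Y (Fin_hat lam) (Fin_hat_le lam) (continuous_functions X Y)"
proof
  obtain d :: "'b \<Rightarrow> 'b \<Rightarrow> 'g" where d: "field_metric (topspace Y) d"
    and top: "\<And>U. openin Y U \<longleftrightarrow>
      U \<subseteq> topspace Y \<and> (\<forall>x\<in>U. \<exists>e>0. {y \<in> topspace Y. d x y < e} \<subseteq> U)"
    using Y unfolding field_metrizable_def by blast
  assume "lam_borel_measurable lam X Y f"
  then show "f \<in> net_closure X Y (Fin_hat lam) (Fin_hat_le lam) (continuous_functions X Y)"
    using borel_function_in_closure[OF co inf clopen wX d top wY A f] by blast
next
  assume "f \<in> net_closure X Y (Fin_hat lam) (Fin_hat_le lam) (continuous_functions X Y)"
  then show "lam_borel_measurable lam X Y f"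
    using net_closure_borel[OF co inf wY field_metrizable_regular[OF Y]] by blast
qed

theorem theorem4p8:
  fixes lam :: "'l rel" and mu :: "'m rel"
    and X :: "'a topology" and Y :: "'b topology" and f :: "'a \<Rightarrow> 'b"
  assumes "Card_order lam" and "natLeq <o lam"
    and "two_pow_less lam =o lam"
    and "has_cofinality lam mu"
    and "natLeq <o mu \<Longrightarrow> has_pos_coinitiality TYPE('g::linordered_field) mu"
    and "space_class TYPE('g) lam mu X"
    and "space_class TYPE('g) lam mu Y"
    and "mu =o natLeq \<Longrightarrow> has_covering_dim X 0"
    and "f \<in> topspace X \<rightarrow>\<^sub>E topspace Y"
  shows "lam_borel_measurable lam X Y f \<longleftrightarrow>
    f \<in> net_closure X Y (Fin_hat lam) (Fin_hat_le lam) (continuous_functions X Y)"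
proof -
  have inf: "infinite (Field lam)"
    using assms(1,2) by (metis Field_natLeq card_of_mono2 card_of_ordLeq_finite
        infinite_UNIV_nat ordLess_imp_ordLeq)
  have co: "Card_order lam" by fact
  obtain K where K: "K \<subseteq> Field lam" "cofinal K lam" "|K| =o mu"
    using assms(4) unfolding has_cofinality_def by blast
  have "infinite K" using cofinal_infinite[OF co inf K(1,2)] .
  then have "natLeq \<le>o |K|" using infinite_iff_natLeq_ordLeq by blast
  then have "natLeq \<le>o mu" using K(3) ordLeq_ordIso_trans by blast
  then have mu_cases: "mu =o natLeq \<or> natLeq <o mu"
    using ordLeq_iff_ordLess_or_ordIso ordIso_symmetric by blast
  have "|K| \<le>o |Field lam|" using K(1) by (rule card_of_mono1)
  then have "|K| \<le>o lam" using Field_le_lam[OF co inf] ordLeq_transitive by blast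
  then have mu_le: "mu \<le>o lam" using K(3) ordIso_ordLeq_trans ordIso_symmetric by blast
  have wX: "weight_le X lam" and wY: "weight_le Y lam"
    and mX: "mu_metrizable TYPE('g) mu X" and mY: "mu_metrizable TYPE('g) mu Y"
    using assms(6,7) unfolding space_class_def by auto
  consider (countable) "mu =o natLeq" | (uncountable) "natLeq <o mu" "\<not> mu =o natLeq"
    using mu_cases by blast
  then show ?thesis
  proof cases
    case countable
    then have X: "metrizable_space X" and "metrizable_space Y"
      using mX mY unfolding mu_metrizable_def by auto
    then have Y: "field_metrizable TYPE(real) Y" by (intro field_metrizable_real)
    have "t1_space X" using X by (simp add: metrizable_imp_t1_space)
    then have clopen: "\<exists>C. openin X C \<and> closedin X C \<and> x \<in> C \<and> C \<subseteq> U"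
      if "openin X U" "x \<in> U" for U x
      using covering_dim_clopen_base[of X U x] that assms(8)[OF countable]
      unfolding has_covering_dim_def by blast
    let ?A = "range (\<lambda>n. inverse (real (Suc n)))"
    have "|?A| \<le>o |UNIV :: nat set|" by (rule card_of_image)
    then have "|?A| \<le>o lam"
      using assms(2) card_of_nat ordLeq_ordIso_trans ordLeq_ordLess_trans ordLess_imp_ordLeq by blast
    moreover have "\<exists>a\<in>?A. a \<le> g" if "g > 0" for g
      using reals_Archimedean[OF that] by (auto intro: less_imp_le)
    moreover have "?A \<subseteq> {0<..}" by auto
    ultimately show ?thesis
      using closure_iff_borel[OF co inf clopen wX Y wY, of ?A f] assms(9) by blast
  next
    case uncountable
    then have X: "field_metrizable TYPE('g) X" and Y: "field_metrizable TYPE('g) Y"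
      using mX mY unfolding mu_metrizable_def by auto
    have coin: "has_pos_coinitiality TYPE('g) mu" using assms(5) uncountable(1) by blast
    note clopen = field_metrizable_clopen_base[OF X coin uncountable(1)]
    obtain A :: "'g set" where A: "A \<subseteq> {0<..}" "\<forall>g>0. \<exists>a\<in>A. a \<le> g" "|A| =o mu"
      using coin unfolding has_pos_coinitiality_def by blast
    have "|A| \<le>o lam" using A(3) mu_le ordIso_ordLeq_trans by blast
    then show ?thesis
      using closure_iff_borel[OF co inf clopen wX Y wY, of A f] A assms(9) by blast
  qed
qed

end
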